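(* Let $g$ and $\ell$ be positive integers, and for every integer $h$ let $n'_{h,\ell}$ denote the number of gapsets of genus $h$ all of whose Kunz coordinates lie in $[\ell, 2\ell+1] \cap \mathbb{Z}$. Then $$\sum_{i=\ell}^{2\ell} n'_{g-i,\ell} \;\leq\; n'_{g,\ell} \;\leq\; \sum_{i=\ell}^{2\ell+1} n'_{g-i,\ell}.$$
   Context: $\mathbb{N}$ denotes the positive integers and $\mathbb{N}_0 = \mathbb{N} \cup \{0\}$. A gapset is a finite set $G \subset \mathbb{N}$ such that whenever $z \in G$ and $z = x + y$ with $x, y \in \mathbb{N}$, then $x \in G$ or $y \in G$. Its genus is $\#G$ and its multiplicity is $m = \min\{s \in \mathbb{N} : s \notin G\}$. For $i \in [1, m-1]\cap\mathbb{Z}$, let $w_i = \min\{s \in \mathbb{N}_0 \setminus G : s \equiv i \pmod m\}$; the Kunz coordinates of $G$ are the tuple $(k_1, \ldots, k_{m-1})$ with $k_i = (w_i - i)/m$ (equivalently $k_i = \#\{z \in G : z \equiv i \pmod m\}$). The empty gapset has multiplicity $1$ and empty tuple of Kunz coordinates, so it vacuously satisfies the coordinate condition and $n'_{0,\ell} = 1$; for $h < 0$, $n'_{h,\ell} = 0$. For $\ell = 1$ the gapsets counted are exactly those of depth at most $3$. *)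

theory Defs
  imports "HOL-Number_Theory.Cong"
begin

definition gapset :: "nat set \<Rightarrow> bool" where
  "gapset G \<longleftrightarrow> finite G \<and> 0 \<notin> G \<and>
     (\<forall>z\<in>G. \<forall>x y. 0 < x \<and> 0 < y \<and> z = x + y \<longrightarrow> x \<in> G \<or> y \<in> G)"

definition genus :: "nat set \<Rightarrow> nat" where
  "genus G = card G"

definition gapset_multiplicity :: "nat set \<Rightarrow> nat" where
  "gapset_multiplicity G = (LEAST s. 0 < s \<and> s \<notin> G)"

definition apery :: "nat set \<Rightarrow> nat \<Rightarrow> nat" where
  "apery G i = (LEAST s. s \<notin> G \<and> [s = i] (mod gapset_multiplicity G))"

(* For 1 <= i < gapset_multiplicity G, apery G i is at least i and congruent to i modulo
   gapset_multiplicity G, so the subtraction does not truncate and the division is exact. *)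
definition kunz_coord :: "nat set \<Rightarrow> nat \<Rightarrow> nat" where
  "kunz_coord G i = (apery G i - i) div gapset_multiplicity G"

definition kunz_coords :: "nat set \<Rightarrow> nat list" where
  "kunz_coords G = map (kunz_coord G) [1..<gapset_multiplicity G]"

(* The genus argument is an integer, so that the count is 0 for negative h. *)
definition num_gapsets :: "int \<Rightarrow> nat \<Rightarrow> nat" where
  "num_gapsets h l =
     card {G. gapset G \<and> int (genus G) = h \<and> set (kunz_coords G) \<subseteq> {l..2 * l + 1}}"

end

theory Submission
  imports Defs "HOL-Library.FuncSet"
begin

text \<open>
  A gapset is recovered from its Kunz coordinates. A word over \<open>[l, 2l + 1]\<close> is a tuple of
  Kunz coordinates iff \<open>k\<^sub>i + k\<^sub>j \<ge> k\<^sub>i\<^sub>+\<^sub>j\<close> for \<open>i + j < m\<close> and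
  \<open>k\<^sub>i + k\<^sub>j + 1 \<ge> k\<^sub>i\<^sub>+\<^sub>j\<^sub>-\<^sub>m\<close> for \<open>i + j > m\<close>. On this alphabet the second condition is
  automatic and the first one only forbids \<open>k\<^sub>i = k\<^sub>j = l\<close> together with
  \<open>k\<^sub>i\<^sub>+\<^sub>j = 2l + 1\<close>. This pattern is created neither by deleting the last letter
  nor by appending a letter in \<open>[l, 2l]\<close>; as the genus is the sum of the word, appending and
  deleting a last letter give the two inequalities.
\<close>

text \<open>The intended inverse of \<open>kunz_coords\<close>: a tuple of m - 1 coordinates belongs
  to multiplicity m, hence the modulus \<open>Suc (length ws)\<close>.\<close>

definition kunz_gaps :: "nat list \<Rightarrow> nat set" where
  "kunz_gaps ws = {z. z mod Suc (length ws) \<noteq> 0 \<and>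
     z div Suc (length ws) < ws ! (z mod Suc (length ws) - 1)}"

text \<open>Lists are indexed from 0, so \<open>ws ! a\<close> is the coordinate \<open>k\<close> with index \<open>a + 1\<close>.\<close>

definition admissible :: "nat \<Rightarrow> nat list \<Rightarrow> bool" where
  "admissible l ws \<longleftrightarrow> set ws \<subseteq> {l..2 * l + 1} \<and>
     (\<forall>a b. a + b + 1 < length ws \<and> ws ! a = l \<and> ws ! b = l \<longrightarrow> ws ! (a + b + 1) \<noteq> 2 * l + 1)"

section \<open>Recovering a gapset from its Kunz coordinates\<close>

lemma gapset_multiplicity_props:
  assumes "gapset G"
  shows "0 < gapset_multiplicity G" and "gapset_multiplicity G \<notin> G"
proof -
  have "finite (insert 0 G)"
    using assms by (simp add: gapset_def)
  then obtain s where "s \<notin> insert 0 G"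
    using ex_new_if_finite infinite_UNIV_nat by blast
  then have "0 < s \<and> s \<notin> G"
    by simp
  then have "0 < gapset_multiplicity G \<and> gapset_multiplicity G \<notin> G"
    unfolding gapset_multiplicity_def by (rule LeastI)
  then show "0 < gapset_multiplicity G" "gapset_multiplicity G \<notin> G"
    by simp_all
qed

text \<open>The multiplicity is not a gap, so splitting it off a gap leaves a gap. Hence the gaps in
  each residue class form an initial segment.\<close>

lemma gapset_diff_mult:
  assumes "gapset G" and "x + gapset_multiplicity G * j \<in> G"
  shows "x \<in> G"
  using assms(2)
proof (induction j)
  case (Suc j)
  let ?m = "gapset_multiplicity G"
  have m: "0 < ?m" "?m \<notin> G"
    using gapset_multiplicity_props[OF assms(1)] by auto
  show ?case
  \<comment> \<open>Splitting needs positive summands; if this one is 0, the gap would be the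
    multiplicity itself.\<close>
  proof (cases "x + ?m * j = 0")
    case True
    then show ?thesis using Suc.prems m by auto
  next
    case False
    have "x + ?m * Suc j = ?m + (x + ?m * j)" by simp
    then have "?m \<in> G \<or> x + ?m * j \<in> G"
      using assms(1) Suc.prems m(1) False unfolding gapset_def by blast
    then show ?thesis using m Suc.IH by blast
  qed
qed simp

text \<open>Evaluates the minimum in \<open>apery\<close>, both for a given gapset and for
  \<open>kunz_gaps ws\<close>.\<close>

lemma Least_cong_class:
  fixes P :: "nat \<Rightarrow> bool"
  assumes "0 < m" and "i < m" and "\<And>j. P (i + m * j) \<longleftrightarrow> k \<le> j"
  shows "(LEAST s. P s \<and> [s = i] (mod m)) = i + m * k"
proof (rule Least_equality)
  show "P (i + m * k) \<and> [i + m * k = i] (mod m)"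
    using assms(3) by (simp add: cong_def)
next
  fix s
  assume s: "P s \<and> [s = i] (mod m)"
  then have "s mod m = i"
    using assms(2) by (simp add: cong_def)
  then have eq: "s = i + m * (s div m)"
    using mod_mult_div_eq[of s m] by simp
  then have "k \<le> s div m"
    using s assms(3) by metis
  then have "m * k \<le> m * (s div m)"
    by simp
  with eq show "i + m * k \<le> s"
    by linarith
qed

lemma gapset_mem_iff:
  assumes "gapset G" and "i < gapset_multiplicity G"
  shows "i + gapset_multiplicity G * j \<in> G \<longleftrightarrow> j < kunz_coord G i"
proof -
  let ?m = "gapset_multiplicity G"
  have m: "0 < ?m"
    using gapset_multiplicity_props(1)[OF assms(1)] .
  define k where "k = (LEAST j. i + ?m * j \<notin> G)"
  have "\<exists>j. i + ?m * j \<notin> G"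
  proof (rule ccontr)
    assume "\<nexists>j. i + ?m * j \<notin> G"
    then have "range (\<lambda>j. i + ?m * j) \<subseteq> G" by auto
    moreover have "finite G" using assms(1) by (simp add: gapset_def)
    ultimately have "finite (range (\<lambda>j. i + ?m * j))" by (rule finite_subset)
    moreover have "inj (\<lambda>j. i + ?m * j)" using m by (auto simp: inj_def)
    ultimately show False using finite_imageD infinite_UNIV_nat by blast
  qed
  then have k: "i + ?m * k \<notin> G"
    unfolding k_def by (rule LeastI_ex)
  have mem: "i + ?m * j \<notin> G \<longleftrightarrow> k \<le> j" for j
  proof
    assume "i + ?m * j \<notin> G"
    then show "k \<le> j" unfolding k_def by (rule Least_le)
  next
    assume "k \<le> j"
    then have "i + ?m * j = i + ?m * k + ?m * (j - k)"
      by (simp add: diff_mult_distrib2)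
    then show "i + ?m * j \<notin> G"
      using k gapset_diff_mult[OF assms(1)] by metis
  qed
  have "apery G i = i + ?m * k"
    unfolding apery_def using Least_cong_class[OF m assms(2) mem] .
  then have "kunz_coord G i = k"
    using m by (simp add: kunz_coord_def)
  then show ?thesis
    using mem[of j] by auto
qed

lemma kunz_gaps_kunz_coords:
  assumes "gapset G"
  shows "kunz_gaps (kunz_coords G) = G"
proof -
  let ?m = "gapset_multiplicity G"
  have m: "0 < ?m" and zero: "0 \<notin> G"
    using gapset_multiplicity_props(1)[OF assms] assms by (auto simp: gapset_def)
  have len: "Suc (length (kunz_coords G)) = ?m"
    using m by (simp add: kunz_coords_def)
  have "z \<in> kunz_gaps (kunz_coords G) \<longleftrightarrow> z \<in> G" for z
  proof (cases "z mod ?m = 0")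
    case True
    \<comment> \<open>The summand 0 fits \<open>gapset_diff_mult\<close>: a multiple of the
      multiplicity in \<open>G\<close> would force 0 into \<open>G\<close>.\<close>
    then have "z = 0 + ?m * (z div ?m)" by auto
    then have "z \<notin> G" using zero gapset_diff_mult[OF assms] by metis
    then show ?thesis using True by (simp add: kunz_gaps_def len)
  next
    case False
    have r: "z mod ?m < ?m" using m by simp
    then have nth: "kunz_coords G ! (z mod ?m - Suc 0) = kunz_coord G (z mod ?m)"
      using False by (simp add: kunz_coords_def)
    have "z \<in> G \<longleftrightarrow> z div ?m < kunz_coord G (z mod ?m)"
      using gapset_mem_iff[OF assms r, of "z div ?m"] by simp
    then show ?thesis using False by (simp add: kunz_gaps_def len nth)
  qed
  then show ?thesis by blast
qed

section \<open>The set of gaps built from a word: multiplicity, coordinates, genus\<close>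

lemma Suc_add_mult_mod_div:
  fixes i j n :: nat
  assumes "i < n"
  shows "(Suc i + Suc n * j) mod Suc n = Suc i" and "(Suc i + Suc n * j) div Suc n = j"
  using assms
  by (metis Suc_mono mod_less mod_mult_self2,
      metis Suc_mono Zero_not_Suc add_0 div_less div_mult_self2 add.commute)

lemma mem_kunz_gaps_iff:
  assumes "i < length ws"
  shows "Suc i + Suc (length ws) * j \<in> kunz_gaps ws \<longleftrightarrow> j < ws ! i"
  by (simp only: kunz_gaps_def mem_Collect_eq Suc_add_mult_mod_div[OF assms]) simp

text \<open>Nonzero letters put all of 1, ..., \<open>length ws\<close> into the set; a letter 0 at
  index i would leave out \<open>Suc i\<close>.\<close>

lemma gapset_multiplicity_kunz_gaps:
  assumes "0 \<notin> set ws"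
  shows "gapset_multiplicity (kunz_gaps ws) = Suc (length ws)"
  unfolding gapset_multiplicity_def
proof (rule Least_equality)
  show "0 < Suc (length ws) \<and> Suc (length ws) \<notin> kunz_gaps ws"
    by (simp add: kunz_gaps_def)
next
  fix s
  assume s: "0 < s \<and> s \<notin> kunz_gaps ws"
  show "Suc (length ws) \<le> s"
  proof (rule ccontr)
    assume "\<not> Suc (length ws) \<le> s"
    then obtain i where i: "s = Suc i" "i < length ws"
      using s by (cases s) auto
    then have "0 < ws ! i"
      using assms by (metis gr0I nth_mem)
    then show False
      using s i mem_kunz_gaps_iff[of i ws 0] by simp
  qed
qed

lemma kunz_coords_kunz_gaps:
  assumes "0 \<notin> set ws"
  shows "kunz_coords (kunz_gaps ws) = ws"
proof (rule nth_equalityI)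
  note m = gapset_multiplicity_kunz_gaps[OF assms]
  show "length (kunz_coords (kunz_gaps ws)) = length ws"
    by (simp add: kunz_coords_def m del: upt_Suc)
  fix i
  assume "i < length (kunz_coords (kunz_gaps ws))"
  then have i: "i < length ws"
    by (simp add: kunz_coords_def m del: upt_Suc)
  have mem: "Suc i + Suc (length ws) * j \<notin> kunz_gaps ws \<longleftrightarrow> ws ! i \<le> j" for j
    using mem_kunz_gaps_iff[OF i, of j] by auto
  have "apery (kunz_gaps ws) (Suc i) = Suc i + Suc (length ws) * ws ! i"
    unfolding apery_def m
    by (rule Least_cong_class) (use i mem in auto)
  then have "kunz_coord (kunz_gaps ws) (Suc i) = ws ! i"
    unfolding kunz_coord_def m by (metis add_diff_cancel_left' nonzero_mult_div_cancel_left nat.distinct(1))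
  then show "kunz_coords (kunz_gaps ws) ! i = ws ! i"
    using i by (simp add: kunz_coords_def m del: upt_Suc)
qed

text \<open>Division with remainder by \<open>Suc (length ws)\<close> gives the inverse map.
  Finiteness of the set and its genus are both read off from this.\<close>

lemma bij_betw_kunz_gaps:
  "bij_betw (\<lambda>(i, j). Suc i + Suc (length ws) * j)
     (SIGMA i:{..<length ws}. {..<ws ! i}) (kunz_gaps ws)"
proof (rule bij_betwI[where g = "\<lambda>z. (z mod Suc (length ws) - 1, z div Suc (length ws))"])
  show "(\<lambda>(i, j). Suc i + Suc (length ws) * j)
      \<in> (SIGMA i:{..<length ws}. {..<ws ! i}) \<rightarrow> kunz_gaps ws"
    using mem_kunz_gaps_iff by fastforce
  show "(\<lambda>z. (z mod Suc (length ws) - 1, z div Suc (length ws)))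
      \<in> kunz_gaps ws \<rightarrow> (SIGMA i:{..<length ws}. {..<ws ! i})"
  proof
    fix z
    assume z: "z \<in> kunz_gaps ws"
    then have "z mod Suc (length ws) - 1 < length ws"
      using mod_less_divisor[OF zero_less_Suc, of z "length ws"]
      unfolding kunz_gaps_def mem_Collect_eq by linarith
    then show "(z mod Suc (length ws) - 1, z div Suc (length ws))
        \<in> (SIGMA i:{..<length ws}. {..<ws ! i})"
      using z unfolding kunz_gaps_def by auto
  qed
next
  fix p
  assume "p \<in> (SIGMA i:{..<length ws}. {..<ws ! i})"
  then obtain i j where p: "p = (i, j)" "i < length ws" by auto
  show "((case p of (i, j) \<Rightarrow> Suc i + Suc (length ws) * j) mod Suc (length ws) - 1,
      (case p of (i, j) \<Rightarrow> Suc i + Suc (length ws) * j) div Suc (length ws)) = p"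
    by (simp only: p(1) prod.case Suc_add_mult_mod_div[OF p(2)]) simp
next
  fix z
  assume "z \<in> kunz_gaps ws"
  then have "Suc (z mod Suc (length ws) - 1) = z mod Suc (length ws)"
    by (simp add: kunz_gaps_def)
  then show "(case (z mod Suc (length ws) - 1, z div Suc (length ws)) of
      (i, j) \<Rightarrow> Suc i + Suc (length ws) * j) = z"
    by (simp only: prod.case mod_mult_div_eq)
qed

lemma finite_kunz_gaps: "finite (kunz_gaps ws)"
  using bij_betw_finite[OF bij_betw_kunz_gaps] by simp

lemma genus_kunz_gaps: "genus (kunz_gaps ws) = sum_list ws"
  using bij_betw_same_card[OF bij_betw_kunz_gaps, of ws]
  by (simp add: genus_def sum_list_sum_nth atLeast0LessThan)

section \<open>Admissible words are exactly the Kunz words over the alphabet\<close>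

lemma admissible_gapset:
  assumes "admissible l ws"
  shows "gapset (kunz_gaps ws)"
  unfolding gapset_def
proof (intro conjI ballI allI impI)
  show "finite (kunz_gaps ws)" by (rule finite_kunz_gaps)
  show "0 \<notin> kunz_gaps ws" by (simp add: kunz_gaps_def)
next
  fix z x y
  assume z: "z \<in> kunz_gaps ws" and "0 < x \<and> 0 < y \<and> z = x + y"
  then have zxy: "z = x + y" by simp
  define m where "m = Suc (length ws)"
  define r where "r = x mod m"
  define s where "s = y mod m"
  have m: "0 < m" by (simp add: m_def)
  have rs: "r < m" "s < m" using m by (simp_all add: r_def s_def)
  have range: "l \<le> ws ! i" "ws ! i \<le> 2 * l + 1" if "i < length ws" for i
    using assms nth_mem[OF that] by (auto simp: admissible_def)
  have mem: "u \<in> kunz_gaps ws \<longleftrightarrow> u mod m \<noteq> 0 \<and> u div m < ws ! (u mod m - 1)" for u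
    by (simp add: kunz_gaps_def m_def)
  \<comment> \<open>Adding x and y adds their quotients by m, plus a carry
    \<open>(r + s) div m\<close> of 0 or 1.\<close>
  have z_eq: "z = (r + s) + m * (x div m + y div m)"
    using mult_div_mod_eq[of m x] mult_div_mod_eq[of m y]
    by (simp add: zxy r_def s_def algebra_simps)
  have z_mod: "z mod m = (r + s) mod m"
    unfolding z_eq by simp
  have z_div: "z div m = (r + s) div m + (x div m + y div m)"
    unfolding z_eq using m by simp
  show "x \<in> kunz_gaps ws \<or> y \<in> kunz_gaps ws"
  proof (rule ccontr)
    assume contra: "\<not> (x \<in> kunz_gaps ws \<or> y \<in> kunz_gaps ws)"
    consider "r = 0" | "s = 0" | "r \<noteq> 0" "s \<noteq> 0" "r + s < m"
      | "r \<noteq> 0" "s \<noteq> 0" "m \<le> r + s"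
      by linarith
    then show False
    proof cases
      \<comment> \<open>z lies in the class of y and its quotient is no smaller, so y would be a
        gap.\<close>
      case 1
      then show ?thesis
        using z contra z_mod z_div rs by (auto simp: mem s_def)
    next
      case 2
      then show ?thesis
        using z contra z_mod z_div rs by (auto simp: mem r_def)
    next
      case 3
      \<comment> \<open>No carry: the quotients add up to at least 2l and stay below a letter of at
        most 2l + 1. All bounds are therefore attained, which is the forbidden pattern.\<close>
      have "ws ! (r - 1) \<le> x div m" "ws ! (s - 1) \<le> y div m"
        using contra 3 by (auto simp: mem r_def s_def)
      moreover have "x div m + y div m < ws ! (r + s - 1)"
        using z z_mod z_div 3 by (simp add: mem)
      moreover have "l \<le> ws ! (r - 1)" "l \<le> ws ! (s - 1)" "ws ! (r + s - 1) \<le> 2 * l + 1"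
        using 3 by (intro range; simp add: m_def)+
      ultimately have "ws ! (r - 1) = l" "ws ! (s - 1) = l" "ws ! (r + s - 1) = 2 * l + 1"
        by linarith+
      moreover have "(r - 1) + (s - 1) + 1 = r + s - 1"
        using 3 by simp
      moreover have "r + s - 1 < length ws"
        using 3 by (simp add: m_def)
      ultimately show ?thesis
        using assms unfolding admissible_def by metis
    next
      case 4
      \<comment> \<open>The carry lifts the quotient of z to at least 2l + 1, and no letter exceeds
        that.\<close>
      have "ws ! (r - 1) \<le> x div m" "ws ! (s - 1) \<le> y div m"
        using contra 4 by (auto simp: mem r_def s_def)
      moreover have "l \<le> ws ! (r - 1)" "l \<le> ws ! (s - 1)"
        using 4 rs by (intro range; simp add: m_def)+
      moreover have "1 \<le> (r + s) div m"
        using 4 m by (simp add: Suc_le_eq div_greater_zero_iff)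
      ultimately have "2 * l + 1 \<le> z div m"
        using z_div by linarith
      moreover have "z mod m \<noteq> 0" "z div m < ws ! (z mod m - 1)"
        using z by (simp_all add: mem)
      moreover have "z mod m - 1 < length ws"
        using \<open>z mod m \<noteq> 0\<close> mod_less_divisor[OF m, of z] unfolding m_def by linarith
      then have "ws ! (z mod m - 1) \<le> 2 * l + 1"
        by (rule range)
      ultimately show ?thesis by linarith
    qed
  qed
qed

text \<open>In a forbidden pattern, the least non-gaps \<open>?x\<close> and \<open>?y\<close> of
  the classes of a + 1 and b + 1 add up to a number with quotient 2l < 2l + 1, hence to a
  gap.\<close>

lemma gapset_admissible:
  assumes "gapset (kunz_gaps ws)" and "set ws \<subseteq> {l..2 * l + 1}"
  shows "admissible l ws"
  unfolding admissible_def
proof (intro conjI allI impI notI)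
  fix a b
  assume ab: "a + b + 1 < length ws \<and> ws ! a = l \<and> ws ! b = l"
    and top: "ws ! (a + b + 1) = 2 * l + 1"
  let ?x = "Suc a + Suc (length ws) * l"
  let ?y = "Suc b + Suc (length ws) * l"
  have "?x + ?y = Suc (a + b + 1) + Suc (length ws) * (2 * l)"
    by (simp add: algebra_simps)
  moreover have "Suc (a + b + 1) + Suc (length ws) * (2 * l) \<in> kunz_gaps ws"
    using ab top by (subst mem_kunz_gaps_iff) auto
  ultimately have "?x + ?y \<in> kunz_gaps ws" by (simp only:)
  moreover have "0 < ?x" "0 < ?y" by simp_all
  ultimately have "?x \<in> kunz_gaps ws \<or> ?y \<in> kunz_gaps ws"
    using assms(1) unfolding gapset_def by blast
  then show False
    using ab mem_kunz_gaps_iff[of a ws l] mem_kunz_gaps_iff[of b ws l] by linarith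
qed (rule assms(2))

section \<open>Counting gapsets as words of given sum\<close>

definition words :: "nat \<Rightarrow> int \<Rightarrow> nat list set" where
  "words l h = {ws. admissible l ws \<and> int (sum_list ws) = h}"

lemma num_gapsets_eq_card_words:
  assumes "0 < l"
  shows "num_gapsets h l = card (words l h)"
proof -
  \<comment> \<open>Positivity of l excludes the letter 0, as inverting \<open>kunz_gaps\<close>
    requires.\<close>
  have pos: "0 \<notin> set ws" if "admissible l ws" for ws
    using that assms by (auto simp: admissible_def)
  have "bij_betw kunz_gaps (words l h)
      {G. gapset G \<and> int (genus G) = h \<and> set (kunz_coords G) \<subseteq> {l..2 * l + 1}}"
  proof (rule bij_betwI[where g = kunz_coords])
    show "kunz_gaps \<in> words l h \<rightarrow>
        {G. gapset G \<and> int (genus G) = h \<and> set (kunz_coords G) \<subseteq> {l..2 * l + 1}}"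
      using admissible_gapset genus_kunz_gaps kunz_coords_kunz_gaps[OF pos]
      by (fastforce simp: words_def admissible_def)
    show "kunz_coords \<in> {G. gapset G \<and> int (genus G) = h \<and>
        set (kunz_coords G) \<subseteq> {l..2 * l + 1}} \<rightarrow> words l h"
      using kunz_gaps_kunz_coords gapset_admissible genus_kunz_gaps
      by (auto simp: words_def) metis+
  qed (use kunz_coords_kunz_gaps[OF pos] kunz_gaps_kunz_coords in \<open>auto simp: words_def\<close>)
  then show ?thesis
    unfolding num_gapsets_def by (simp add: bij_betw_same_card)
qed

text \<open>Letters are at least 1, so the sum of a word bounds its length.\<close>

lemma finite_words:
  assumes "0 < l"
  shows "finite (words l h)"
proof (rule finite_subset)
  show "words l h \<subseteq> {ws. set ws \<subseteq> {l..2 * l + 1} \<and> length ws \<le> nat h}"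
  proof
    fix ws
    assume ws: "ws \<in> words l h"
    then have "sum_list (map (\<lambda>_. 1) ws) \<le> sum_list (map id ws)"
      using assms by (intro sum_list_mono) (auto simp: words_def admissible_def)
    then show "ws \<in> {ws. set ws \<subseteq> {l..2 * l + 1} \<and> length ws \<le> nat h}"
      using ws by (auto simp: words_def admissible_def sum_list_triv)
  qed
qed (simp add: finite_lists_length_le)

section \<open>Deleting and appending a last letter\<close>

lemma admissible_butlast:
  assumes "admissible l (ws @ [k])"
  shows "admissible l ws" and "k \<in> {l..2 * l + 1}"
proof -
  have "ws ! (a + b + 1) \<noteq> 2 * l + 1"
    if "a + b + 1 < length ws" "ws ! a = l" "ws ! b = l" for a b
  proof -
    have "a + b + 1 < length (ws @ [k])" "(ws @ [k]) ! a = l" "(ws @ [k]) ! b = l"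
      using that by (simp_all add: nth_append)
    then have "(ws @ [k]) ! (a + b + 1) \<noteq> 2 * l + 1"
      using assms unfolding admissible_def by blast
    then show ?thesis
      using that by (simp add: nth_append)
  qed
  then show "admissible l ws" "k \<in> {l..2 * l + 1}"
    using assms by (auto simp: admissible_def)
qed

text \<open>Since a and b are smaller than a + b + 1, a new pattern can use the last position only
  for the letter \<open>2 * l + 1\<close>, which the bound on \<open>k\<close> excludes.\<close>

lemma admissible_snoc:
  assumes "admissible l ws" and "k \<in> {l..2 * l}"
  shows "admissible l (ws @ [k])"
  using assms unfolding admissible_def by (auto simp: nth_append less_Suc_eq)

text \<open>Appending a fixed letter is injective, and different last letters give disjoint
  images.\<close>

lemma card_snoc_words:
  assumes "0 < l" and "finite I"
  shows "card (\<Union>i\<in>I. (\<lambda>ws. ws @ [i]) ` words l (h - int i)) =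
    (\<Sum>i\<in>I. num_gapsets (h - int i) l)"
proof -
  have "card (\<Union>i\<in>I. (\<lambda>ws. ws @ [i]) ` words l (h - int i)) =
      (\<Sum>i\<in>I. card ((\<lambda>ws. ws @ [i]) ` words l (h - int i)))"
    using assms finite_words by (intro card_UN_disjoint) auto
  also have "\<dots> = (\<Sum>i\<in>I. num_gapsets (h - int i) l)"
    using assms(1) by (intro sum.cong) (auto simp: card_image inj_on_def num_gapsets_eq_card_words)
  finally show ?thesis .
qed

theorem theorem7:
  fixes g l :: nat
  assumes "0 < g" and "0 < l"
  shows "(\<Sum>i=l..2 * l. num_gapsets (int g - int i) l) \<le> num_gapsets (int g) l \<and>
         num_gapsets (int g) l \<le> (\<Sum>i=l..2 * l + 1. num_gapsets (int g - int i) l)"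
proof
  \<comment> \<open>For i > g the set \<open>words l (int g - int i)\<close> is empty, so these
    summands contribute 0.\<close>
  have "(\<Union>i\<in>{l..2 * l}. (\<lambda>ws. ws @ [i]) ` words l (int g - int i)) \<subseteq> words l (int g)"
    using admissible_snoc by (auto simp: words_def)
  from card_mono[OF finite_words[OF assms(2)] this]
  show "(\<Sum>i=l..2 * l. num_gapsets (int g - int i) l) \<le> num_gapsets (int g) l"
    by (simp only: card_snoc_words[OF assms(2) finite_atLeastAtMost]
        num_gapsets_eq_card_words[OF assms(2), symmetric])
next
  let ?U = "\<Union>i\<in>{l..2 * l + 1}. (\<lambda>ws. ws @ [i]) ` words l (int g - int i)"
  \<comment> \<open>The deleted letter may be \<open>2 * l + 1\<close>, hence one more summand than
    in the lower bound. A last letter exists because g > 0 rules out the empty word.\<close>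
  have "words l (int g) \<subseteq> ?U"
  proof
    fix ws
    assume ws: "ws \<in> words l (int g)"
    then have "ws \<noteq> []"
      using assms(1) by (auto simp: words_def)
    then obtain vs k where vs: "ws = vs @ [k]"
      by (metis rev_exhaust)
    then have "vs \<in> words l (int g - int k)" "k \<in> {l..2 * l + 1}"
      using ws admissible_butlast[of l vs k] by (auto simp: words_def)
    then show "ws \<in> ?U"
      using vs by blast
  qed
  moreover have "finite ?U"
    using finite_words[OF assms(2)] by blast
  ultimately have "card (words l (int g)) \<le> card ?U"
    by (intro card_mono)
  then show "num_gapsets (int g) l \<le> (\<Sum>i=l..2 * l + 1. num_gapsets (int g - int i) l)"
    by (simp only: card_snoc_words[OF assms(2) finite_atLeastAtMost]
        num_gapsets_eq_card_words[OF assms(2), symmetric])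
qed

end
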